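(* Let $p$ be a prime and let $a\in\mathbb{Z}_p^{\times}$ be panmagic. Then the disjoint cycle decomposition of $\pi_a$ consists of one fixed point and $\frac{p-1}{\operatorname{ord}_p(a)}$ cycles of equal length $\operatorname{ord}_p(a)$. Moreover, every permutation in $\pi_aD_p$ has the cycle type of $\pi_a$ or of $\pi_{-a}$.
   Context: $S_p$ is the group of permutations of $\{1,\dots,p\}$, identified with the group of permutations of the residues $\mathbb{Z}_p$ (with $p$ identified with the residue $0$). $\phi(i)\equiv 1-i$ is the flip and $\varkappa(i)\equiv i+1\pmod p$ is the cyclic shift; $D_p:=\langle\phi,\varkappa\rangle\le S_p$ is the dihedral group. For $a\in\mathbb{Z}_p^\times$ (the units of $\mathbb{Z}_p$), $\pi_a\in S_p$ is $\pi_a(i)\equiv ai\pmod p$, and $\pi_aD_p$ is the left coset. A unit $a\in\mathbb{Z}_p^\times$ is called panmagic if $a+1$ and $a-1$ are also units, i.e. $a\ne 0,\pm1$. $\operatorname{ord}_p(x)$ is the multiplicative order of $x\in\mathbb{Z}_p^\times$. The cycle type of a permutation is the number and lengths of the cycles in its disjoint cycle decomposition. *)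

theory Defs
  imports
    "HOL-Algebra.Sym_Groups"
    "HOL-Number_Theory.Residues"
    "HOL-Combinatorics.Orbits"
    "HOL-Library.Multiset"
begin

section \<open>Disjoint cycle decompositions and cycle types\<close>

text \<open>Every point of \<open>S\<close> occurs in exactly one cycle; fixed points are the cycles of length 1.\<close>

definition disjoint_cycle_decomposition :: "'a set \<Rightarrow> ('a \<Rightarrow> 'a) \<Rightarrow> 'a list list \<Rightarrow> bool" where
  "disjoint_cycle_decomposition S f css \<longleftrightarrow>
     [] \<notin> set css \<and> distinct (concat css) \<and> set (concat css) = S \<and>
     f = foldr (\<circ>) (map cycle_of_list css) id"

definition cycle_type :: "'a set \<Rightarrow> ('a \<Rightarrow> 'a) \<Rightarrow> nat multiset" where
  "cycle_type S f =
     (THE M. \<exists>css. disjoint_cycle_decomposition S f css \<and> M = mset (map length css))"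

lemma disjoint_cycle_decomposition_exists:
  assumes "f permutes S" "finite S"
  shows "\<exists>css. disjoint_cycle_decomposition S f css"
  using cycle_decomposition[OF assms]
proof (induction rule: cycle_decomp.induct)
  case empty
  show ?case
    by (rule exI[of _ "[]"]) (simp add: disjoint_cycle_decomposition_def id_def)
next
  case (comp I p cs)
  then obtain css where css: "disjoint_cycle_decomposition I p css" by blast
  show ?case
  proof (cases "cs = []")
    case True
    then show ?thesis using css by auto
  next
    case False
    have "disjoint_cycle_decomposition (set cs \<union> I) (cycle_of_list cs \<circ> p) (cs # css)"
      using css comp.hyps False by (auto simp: disjoint_cycle_decomposition_def)
    then show ?thesis by blast
  qed
qed

lemma foldr_cycles_id_outside:
  "x \<notin> set (concat css) \<Longrightarrow> foldr (\<circ>) (map cycle_of_list css) id x = x"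
  by (induction css) (auto simp: id_outside_supp)

lemma foldr_cycles_apply:
  assumes "distinct (concat css)" "cs \<in> set css" "x \<in> set cs"
  shows "foldr (\<circ>) (map cycle_of_list css) id x = cycle_of_list cs x"
  using assms
proof (induction css)
  case (Cons ds css)
  show ?case
  proof (cases "x \<in> set ds")
    case True
    then have "x \<notin> set (concat css)" using Cons.prems by auto
    moreover have "cs = ds" using Cons.prems True by auto
    ultimately have "foldr (\<circ>) (map cycle_of_list css) id x = x"
      by (intro foldr_cycles_id_outside)
    moreover have "foldr (\<circ>) (map cycle_of_list (ds # css)) id x =
        cycle_of_list ds (foldr (\<circ>) (map cycle_of_list css) id x)"
      by simp
    ultimately show ?thesis using \<open>cs = ds\<close> by metis
  next
    case False
    then have cs: "cs \<in> set css" using Cons.prems by auto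
    have "cycle_of_list cs x \<in> set cs"
      using Cons.prems(3) cycle_permutes[of cs] by (simp add: permutes_in_image)
    then have "cycle_of_list cs x \<notin> set ds" using Cons.prems(1) cs by auto
    then show ?thesis using Cons cs by (simp add: id_outside_supp)
  qed
qed simp

lemma orbit_disjoint_cycle_decomposition:
  assumes d: "disjoint_cycle_decomposition S f css" and cs: "cs \<in> set css" and x: "x \<in> set cs"
  shows "orbit f x = set cs"
proof -
  have dist: "distinct (concat css)" and f: "f = foldr (\<circ>) (map cycle_of_list css) id"
    using d by (auto simp: disjoint_cycle_decomposition_def)
  have dcs: "distinct cs" using dist cs by (auto simp: distinct_concat_iff)
  have app: "f y = cycle_of_list cs y" if "y \<in> set cs" for y
    using foldr_cycles_apply[OF dist cs that] f by simp
  have "(f ^^ n) y = (cycle_of_list cs ^^ n) y \<and> (f ^^ n) y \<in> set cs" if "y \<in> set cs" for y n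
    using that
  proof (induction n)
    case (Suc n)
    then show ?case
      using app cycle_permutes[of cs] by (auto simp: permutes_in_image)
  qed simp
  moreover have rot: "(cycle_of_list cs ^^ n) (cs ! i) = cs ! ((n + i) mod length cs)"
    if "i < length cs" for n i
  proof -
    have "(cycle_of_list cs ^^ n) (cs ! i) = map (cycle_of_list cs ^^ n) cs ! i"
      using that by simp
    also have "\<dots> = rotate n cs ! i" using cyclic_rotation[OF dcs, of n] by simp
    finally show ?thesis using that by (simp add: nth_rotate add.commute)
  qed
  ultimately have pow: "(f ^^ n) (cs ! i) = cs ! ((n + i) mod length cs)" if "i < length cs" for n i
    using that by simp
  obtain i where i: "i < length cs" "x = cs ! i" using x by (auto simp: in_set_conv_nth)
  have "orbit f x = {(f ^^ n) x | n. 0 < n}" by (rule orbit_altdef)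
  also have "\<dots> = set cs"
  proof (intro Set.set_eqI iffI)
    fix y assume "y \<in> {(f ^^ n) x | n. 0 < n}"
    then obtain n where "y = cs ! ((n + i) mod length cs)" using pow i by auto
    moreover have "(n + i) mod length cs < length cs" using i by (intro mod_less_divisor) linarith
    ultimately show "y \<in> set cs" by simp
  next
    fix y assume "y \<in> set cs"
    then obtain j where j: "j < length cs" "y = cs ! j" by (auto simp: in_set_conv_nth)
    let ?n = "j + length cs - i"
    have "(f ^^ ?n) x = y" "0 < ?n" using pow[of i ?n] i j by auto
    then show "y \<in> {(f ^^ n) x | n. 0 < n}" by blast
  qed
  finally show ?thesis .
qed

lemma mset_lengths_disjoint_cycle_decomposition:
  assumes d: "disjoint_cycle_decomposition S f css"
  shows "mset (map length css) = image_mset card (mset_set (orbit f ` S))"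
proof -
  have dist: "distinct (concat css)" and ne: "[] \<notin> set css" and S: "S = (\<Union>cs\<in>set css. set cs)"
    using d by (auto simp: disjoint_cycle_decomposition_def)
  have orb: "orbit f ` S = set (map set css)"
  proof (intro Set.set_eqI iffI)
    fix X assume "X \<in> orbit f ` S"
    then show "X \<in> set (map set css)"
      using orbit_disjoint_cycle_decomposition[OF d] S by auto
  next
    fix X assume "X \<in> set (map set css)"
    then obtain cs where cs: "cs \<in> set css" "X = set cs" by auto
    then have "cs \<noteq> []" using ne by auto
    then obtain x where "x \<in> set cs" using hd_in_set by blast
    then show "X \<in> orbit f ` S"
      using orbit_disjoint_cycle_decomposition[OF d cs(1)] S cs by (intro image_eqI[of _ _ x]) auto
  qed
  have "distinct (map set css)"
    using dist ne
  proof (induction css)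
    case (Cons cs css)
    have "set cs \<noteq> set ds" if "ds \<in> set css" for ds
    proof
      assume "set cs = set ds"
      moreover have "hd cs \<in> set cs" using Cons.prems by (intro hd_in_set) auto
      ultimately show False using Cons.prems that by auto
    qed
    then show ?case using Cons by auto
  qed simp
  then have "mset_set (orbit f ` S) = mset (map set css)"
    using orb mset_set_set[of "map set css"] by simp
  then have "image_mset card (mset_set (orbit f ` S)) = mset (map (\<lambda>cs. card (set cs)) css)"
    by (simp add: multiset.map_comp o_def)
  moreover have "map (\<lambda>cs. card (set cs)) css = map length css"
    using dist by (intro map_cong) (auto simp: distinct_concat_iff distinct_card)
  ultimately show ?thesis by (simp only:)
qed

lemma cycle_type_eq:
  assumes "disjoint_cycle_decomposition S f css"
  shows "cycle_type S f = mset (map length css)"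
  unfolding cycle_type_def
proof (rule the_equality)
  show "\<exists>css'. disjoint_cycle_decomposition S f css' \<and> mset (map length css) = mset (map length css')"
    using assms by blast
next
  fix M assume "\<exists>css'. disjoint_cycle_decomposition S f css' \<and> M = mset (map length css')"
  then show "M = mset (map length css)"
    using mset_lengths_disjoint_cycle_decomposition assms by metis
qed

lemma cycle_type_orbits:
  assumes "f permutes S" "finite S"
  shows "cycle_type S f = image_mset card (mset_set (orbit f ` S))"
  using disjoint_cycle_decomposition_exists[OF assms] cycle_type_eq
    mset_lengths_disjoint_cycle_decomposition by metis


section \<open>Permutations of residues\<close>

text \<open>\<open>residue_rep p x\<close> is the element of \<open>{1..p}\<close> congruent to \<open>x\<close>; the class of 0 is
  represented by \<open>p\<close>.\<close>

definition residue_rep :: "nat \<Rightarrow> int \<Rightarrow> nat" where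
  "residue_rep p x = nat ((x - 1) mod int p) + 1"

text \<open>Elements of \<^term>\<open>sym_group p\<close> are functions on \<^typ>\<open>nat\<close> that are the identity
  outside \<open>{1..p}\<close>.\<close>

definition residue_map :: "nat \<Rightarrow> (int \<Rightarrow> int) \<Rightarrow> nat \<Rightarrow> nat" where
  "residue_map p g i = (if i \<in> {1..p} then residue_rep p (g (int i)) else i)"

definition flip :: "nat \<Rightarrow> nat \<Rightarrow> nat" where
  "flip p = residue_map p (\<lambda>i. 1 - i)"

definition shift :: "nat \<Rightarrow> nat \<Rightarrow> nat" where
  "shift p = residue_map p (\<lambda>i. i + 1)"

definition mult_perm :: "nat \<Rightarrow> int \<Rightarrow> nat \<Rightarrow> nat" where
  "mult_perm p a = residue_map p (\<lambda>i. a * i)"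

definition dihedral :: "nat \<Rightarrow> (nat \<Rightarrow> nat) set" where
  "dihedral p = generate (sym_group p) {flip p, shift p}"

definition panmagic :: "nat \<Rightarrow> int \<Rightarrow> bool" where
  "panmagic p a \<longleftrightarrow>
     (let R = residue_ring (int p)
      in a \<in> Units R \<and> a \<oplus>\<^bsub>R\<^esub> \<one>\<^bsub>R\<^esub> \<in> Units R \<and> a \<ominus>\<^bsub>R\<^esub> \<one>\<^bsub>R\<^esub> \<in> Units R)"

lemma residue_rep_bounds:
  assumes "p > 0"
  shows "residue_rep p x \<in> {1..p}"
proof -
  have "0 \<le> (x - 1) mod int p" "(x - 1) mod int p < int p" using assms by auto
  then show ?thesis unfolding residue_rep_def by auto
qed

lemma residue_rep_cong:
  assumes "p > 0"
  shows "[int (residue_rep p x) = x] (mod int p)"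
proof -
  have "int (residue_rep p x) = (x - 1) mod int p + 1"
    using assms by (simp add: residue_rep_def)
  then show ?thesis by (simp add: cong_def mod_add_left_eq)
qed

lemma residue_map_permutes:
  assumes "\<And>i j. [g i = g j] (mod int p) \<Longrightarrow> [i = j] (mod int p)"
  shows "residue_map p g permutes {1..p}"
proof (rule bij_imp_permutes)
  have "inj_on (residue_map p g) {1..p}"
  proof (rule inj_onI)
    fix i j assume ij: "i \<in> {1..p}" "j \<in> {1..p}" "residue_map p g i = residue_map p g j"
    then have "p > 0" by auto
    have "residue_rep p (g (int i)) = residue_rep p (g (int j))"
      using ij by (simp add: residue_map_def)
    then have "[g (int i) = g (int j)] (mod int p)"
      using residue_rep_cong[OF \<open>p > 0\<close>] by (metis cong_sym cong_trans)
    then have "[int i = int j] (mod int p)" by (rule assms)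
    then have "int p dvd int i - int j" by (simp add: cong_iff_dvd_diff)
    moreover have "\<bar>int i - int j\<bar> < int p" using ij by auto
    ultimately have "int i - int j = 0" using dvd_imp_le_int[of "int i - int j" "int p"] by linarith
    then show "i = j" by simp
  qed
  moreover have "residue_map p g ` {1..p} \<subseteq> {1..p}"
    using residue_rep_bounds[of p] by (auto simp: residue_map_def)
  ultimately show "bij_betw (residue_map p g) {1..p} {1..p}"
    using endo_inj_surj[of "{1..p}" "residue_map p g"] by (simp only: bij_betw_def finite_atLeastAtMost)
qed (unfold residue_map_def, simp only: if_False)

lemma flip_in_sym_group: "flip p \<in> carrier (sym_group p)"
  unfolding sym_group_carrier flip_def
proof (rule residue_map_permutes)
  fix i j :: int
  assume "[1 - i = 1 - j] (mod int p)"
  then have "int p dvd - (i - j)" by (simp add: cong_iff_dvd_diff)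
  then show "[i = j] (mod int p)" unfolding dvd_minus_iff by (simp add: cong_iff_dvd_diff)
qed

lemma shift_in_sym_group: "shift p \<in> carrier (sym_group p)"
  unfolding sym_group_carrier shift_def
  by (rule residue_map_permutes) (simp add: cong_iff_dvd_diff)

lemma mult_perm_in_sym_group:
  assumes "coprime a (int p)"
  shows "mult_perm p a \<in> carrier (sym_group p)"
  unfolding sym_group_carrier mult_perm_def
  by (rule residue_map_permutes) (use assms in \<open>simp add: cong_mult_lcancel\<close>)

end

theory Submission
  imports Defs
begin

text \<open>The maps \<open>\<pi>\<^sub>a\<close> and all members of the coset \<open>\<pi>\<^sub>a D\<^sub>p\<close> are affine modulo \<open>p\<close>: elements of the
  dihedral group have the form \<open>i \<mapsto> \<plusminus>i + d\<close> (\<open>dihedral_affine\<close>), hence composing with \<open>\<pi>\<^sub>a\<close> gives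
  \<open>i \<mapsto> \<plusminus>a i + a d\<close>.  Both halves of the theorem therefore follow from one fact
  (\<open>cycle_type_affine\<close>): if \<open>c\<close> is a unit other than \<open>1\<close>, then the cycle type of a permutation
  \<open>i \<mapsto> c i + d\<close> depends on \<open>c\<close> alone.

  Since \<open>1 - c\<close> is invertible, such a permutation has a fixed point \<open>e = d / (1 - c)\<close>.  In the
  coordinate \<open>i - e\<close> it is multiplication by \<open>c\<close>, so its \<open>n\<close>-th power fixes a point \<open>i \<noteq> e\<close> iff
  \<open>(c\<^sup>n - 1) (i - e)\<close> vanishes, that is, iff \<open>c\<^sup>n = 1\<close>, because \<open>i - e\<close> is invertible modulo the
  prime \<open>p\<close>.  This holds iff the order \<open>m\<close> of \<open>c\<close> divides \<open>n\<close>.  Thus every point other than \<open>e\<close>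
  lies on a cycle of length \<open>m\<close>, and these cycles partition the remaining \<open>p - 1\<close> points
  (\<open>cycle_type_one_fixed_point\<close>).

  Being panmagic enters in that \<open>a - 1\<close> and \<open>a + 1\<close> are nonzero, which makes both slopes \<open>a\<close> and \<open>-a\<close>
  different from \<open>1\<close>.\<close>

section \<open>Permutations that are semiregular off one fixed point\<close>

lemma card_orbit_eq_period:
  assumes "m > 0" and period: "\<And>n. (f ^^ n) x = x \<longleftrightarrow> m dvd n"
  shows "card (orbit f x) = m"
proof -
  have x: "(f ^^ m) x = x" using period by simp
  then have self: "x \<in> orbit f x" using \<open>m > 0\<close> unfolding orbit_altdef by force
  let ?d = "funpow_dist1 f x x"
  have "m dvd ?d" using funpow_dist1_prop[OF self] period by blast
  moreover have "?d \<le> m" using funpow_dist1_le_self[OF x \<open>m > 0\<close> self] .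
  ultimately have "?d = m" using dvd_imp_le[of m ?d] by simp
  then show ?thesis
    using orbit_conv_funpow_dist1[OF self] inj_on_funpow_dist1[OF self] by (simp add: card_image)
qed

text \<open>The orbits other than \<open>{e}\<close> partition \<open>S - {e}\<close> into blocks of the same size \<open>m\<close>, which
  determines their number.\<close>

lemma cycle_type_one_fixed_point:
  assumes f: "f permutes S" and fin: "finite S" and e: "e \<in> S" "f e = e" and "m > 0"
    and period: "\<And>x n. x \<in> S \<Longrightarrow> x \<noteq> e \<Longrightarrow> (f ^^ n) x = x \<longleftrightarrow> m dvd n"
  shows "cycle_type S f = {#1#} + replicate_mset ((card S - 1) div m) m"
proof -
  let ?C = "orbit f ` (S - {e})"
  have cyc: "cyclic_on f (orbit f x)" for x using cyclic_on_orbit[OF f fin] .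
  have self: "x \<in> orbit f x" for x
    by (rule permutation_self_in_orbit) (use f fin in \<open>auto simp: permutation_permutes\<close>)
  have e_orb: "orbit f e = {e}" using e by (simp add: orbit_eq_singleton_iff)
  have e_notin: "e \<notin> orbit f x" if "x \<in> S - {e}" for x
    using that orbit_cyclic_eq3[OF cyc, of e x] e_orb self[of x] by auto
  have Un: "\<Union>?C = S - {e}"
    using permutes_orbit_subset[OF f] self e_notin by blast
  have card_C: "card A = m" if "A \<in> ?C" for A
    using that card_orbit_eq_period[OF \<open>m > 0\<close> period] by auto
  have "m * card ?C = card (\<Union>?C)"
  proof (rule card_partition)
    show "A \<inter> B = {}" if "A \<in> ?C" "B \<in> ?C" "A \<noteq> B" for A B
    proof (rule ccontr)
      assume "A \<inter> B \<noteq> {}"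
      then obtain z where z: "z \<in> A" "z \<in> B" by blast
      obtain x y where AB: "A = orbit f x" "B = orbit f y"
        using \<open>A \<in> ?C\<close> \<open>B \<in> ?C\<close> by blast
      have "orbit f z = A" "orbit f z = B"
        using z unfolding AB by (auto dest: orbit_cyclic_eq3[OF cyc])
      then show False using \<open>A \<noteq> B\<close> by simp
    qed
  qed (use fin Un card_C in auto)
  then have "m * card ?C = card S - 1" unfolding Un using fin e by simp
  then have num: "card ?C = (card S - 1) div m"
    using \<open>m > 0\<close> nonzero_mult_div_cancel_left[of m "card ?C"] by simp
  have "orbit f ` S = insert {e} ?C" using e e_orb by blast
  moreover have "{e} \<notin> ?C" using Un by blast
  ultimately have "cycle_type S f = {#1#} + image_mset card (mset_set ?C)"
    using cycle_type_orbits[OF f fin] fin by simp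
  also have "image_mset card (mset_set ?C) = image_mset (\<lambda>_. m) (mset_set ?C)"
    using card_C fin by (intro image_mset_cong) simp
  also have "\<dots> = replicate_mset (card ?C) m" by (simp add: image_mset_const_eq)
  finally show ?thesis unfolding num .
qed

section \<open>Affine permutations of the residues\<close>

text \<open>Only the action on \<open>{1..p}\<close> is constrained, so \<open>c\<close> and \<open>d\<close> matter only modulo \<open>p\<close> and no
  representative of a residue has to be chosen when maps are composed.\<close>

definition affine_mod :: "nat \<Rightarrow> int \<Rightarrow> int \<Rightarrow> (nat \<Rightarrow> nat) \<Rightarrow> bool" where
  "affine_mod p c d f \<longleftrightarrow> (\<forall>i\<in>{1..p}. [int (f i) = c * int i + d] (mod int p))"

lemma cong_imp_eq_in_range:
  assumes "i \<in> {1..p}" "j \<in> {1..p}" "[int i = int j] (mod int p)"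
  shows "i = j"
proof -
  have "int p dvd int i - int j" using assms(3) by (simp add: cong_iff_dvd_diff)
  moreover have "\<bar>int i - int j\<bar> < int p" using assms(1,2) by auto
  ultimately have "int i - int j = 0" using dvd_imp_le_int[of "int i - int j" "int p"] by linarith
  then show ?thesis by simp
qed

lemma affine_mod_residue_map:
  "affine_mod p c d (residue_map p (\<lambda>i. c * i + d))"
  unfolding affine_mod_def residue_map_def by (auto intro: residue_rep_cong)

lemma affine_mod_comp:
  assumes "affine_mod p c d f" "affine_mod p c' d' g" "g permutes {1..p}"
  shows "affine_mod p (c * c') (c * d' + d) (f \<circ> g)"
  unfolding affine_mod_def
proof
  fix i assume i: "i \<in> {1..p}"
  then have "g i \<in> {1..p}" using assms(3) by (simp only: permutes_in_image)
  then have "[int (f (g i)) = c * int (g i) + d] (mod int p)"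
    using assms(1) unfolding affine_mod_def by blast
  also have "[c * int (g i) + d = c * (c' * int i + d') + d] (mod int p)"
    using assms(2) i unfolding affine_mod_def by (intro cong_add cong_mult cong_refl) auto
  finally show "[int ((f \<circ> g) i) = c * c' * int i + (c * d' + d)] (mod int p)"
    by (simp add: algebra_simps)
qed

lemma affine_mod_cong_slope:
  assumes "affine_mod p c d f" "[c = c'] (mod int p)"
  shows "affine_mod p c' d f"
  using assms unfolding affine_mod_def by (meson cong_add cong_mult cong_refl cong_trans)

text \<open>An affine map of slope \<open>s\<close> with \<open>s\<^sup>2 = 1\<close> has an inverse of the same slope, so slopes
  \<open>1\<close> and \<open>-1\<close> need no modular inverses.\<close>

lemma affine_mod_inv:
  assumes s: "s * s = 1" and h: "h permutes {1..p}" "affine_mod p s d h"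
  shows "affine_mod p s (- s * d) (Hilbert_Choice.inv h)"
  unfolding affine_mod_def
proof
  fix i assume i: "i \<in> {1..p}"
  let ?j = "Hilbert_Choice.inv h i"
  have "?j \<in> {1..p}" using i by (simp only: permutes_in_image[OF permutes_inv[OF h(1)]])
  then have "[int (h ?j) = s * int ?j + d] (mod int p)" using h(2) unfolding affine_mod_def by blast
  then have "[s * (int i - d) = s * (s * int ?j + d - d)] (mod int p)"
    using permutes_inverses(1)[OF h(1)] by (intro cong_mult cong_diff cong_refl) simp
  also have "s * (s * int ?j + d - d) = int ?j" by (simp add: s flip: mult.assoc)
  finally show "[int ?j = s * int i + - s * d] (mod int p)"
    by (simp add: algebra_simps cong_sym_eq)
qed

text \<open>Translating the fixed point \<open>e\<close> to the origin turns an affine map into multiplication by its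
  slope, so that iterating it multiplies the distance to \<open>e\<close> by powers of the slope.\<close>

lemma affine_mod_funpow:
  assumes f: "affine_mod p c d f" "f permutes {1..p}"
    and e: "e \<in> {1..p}" "f e = e" and i: "i \<in> {1..p}"
  shows "[int ((f ^^ n) i) - int e = c ^ n * (int i - int e)] (mod int p)"
proof (induction n)
  case (Suc n)
  let ?j = "(f ^^ n) i"
  have "?j \<in> {1..p}" using permutes_in_image[OF permutes_funpow[OF f(2)]] i by simp
  then have "[int (f ?j) - int (f e) = (c * int ?j + d) - (c * int e + d)] (mod int p)"
    using f(1) e(1) unfolding affine_mod_def by (intro cong_diff) blast+
  also have "(c * int ?j + d) - (c * int e + d) = c * (int ?j - int e)" by (simp add: algebra_simps)
  also have "[\<dots> = c * (c ^ n * (int i - int e))] (mod int p)"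
    using Suc by (intro cong_mult cong_refl)
  finally show ?case using e by (simp add: mult.assoc)
qed simp

text \<open>This connects the order in the unit group of the residue ring with integer congruences, the
  language in which affine maps are iterated.\<close>

lemma ord_units_residue_ring:
  assumes "prime p" "u \<in> Units (residue_ring (int p))"
  shows "group.ord (units_of (residue_ring (int p))) u dvd n \<longleftrightarrow> [u ^ n = 1] (mod int p)"
    and "group.ord (units_of (residue_ring (int p))) u > 0"
proof -
  let ?R = "residue_ring (int p)"
  interpret residues_prime p ?R using assms(1) by unfold_locales simp_all
  interpret U: group "units_of ?R" by (rule units_group)
  have "u \<in> carrier (units_of ?R)" using assms(2) by (simp add: units_of_carrier)
  note u = this assms(2)
  have um: "u mod int p = u" using u(2) by (simp add: res_units_eq)
  have "U.ord u dvd n \<longleftrightarrow> u [^]\<^bsub>units_of ?R\<^esub> n = \<one>\<^bsub>units_of ?R\<^esub>"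
    using U.pow_eq_id[OF u(1)] by simp
  also have "\<dots> \<longleftrightarrow> u [^]\<^bsub>?R\<^esub> n = \<one>\<^bsub>?R\<^esub>" using units_of_pow[OF u(2)] by (simp add: units_of_one)
  also have "\<dots> \<longleftrightarrow> [u ^ n = 1] (mod int p)"
    using pow_cong[of u n] by (simp add: um one_cong cong_def)
  finally show "U.ord u dvd n \<longleftrightarrow> [u ^ n = 1] (mod int p)" .
  have "finite (carrier (units_of ?R))" by (simp add: units_of_carrier)
  then show "U.ord u > 0" using U.ord_ge_1[OF _ u(1)] by simp
qed

text \<open>The right-hand side does not mention the translation part \<open>d\<close>: it can be conjugated away by
  moving the fixed point \<open>d / (1 - c)\<close> to the origin.\<close>

lemma cycle_type_affine:
  assumes p: "prime p" and c: "c \<in> Units (residue_ring (int p))" "c \<noteq> 1"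
    and f: "f permutes {1..p}" "affine_mod p c d f"
  defines "m \<equiv> group.ord (units_of (residue_ring (int p))) c"
  shows "cycle_type {1..p} f = {#1#} + replicate_mset ((p - 1) div m) m"
proof -
  interpret residues_prime p "residue_ring (int p)" using p by unfold_locales simp_all
  have p0: "p > 0" using p by (rule prime_gt_0_nat)
  have "1 < c" "c < int p" using c res_prime_units_eq by auto
  then have "\<not> int p dvd 1 - c" using zdvd_not_zless[of "c - 1" "int p"] by (simp add: dvd_diff_commute)
  then have "coprime (1 - c) (int p)" by (simp add: p_coprime_right_int)
  then obtain x where x: "[(1 - c) * x = 1] (mod int p)" using cong_solve_coprime_int by blast
  \<comment> \<open>\<open>x\<close> is the inverse of \<open>1 - c\<close>, so this is the solution \<open>d / (1 - c)\<close> of \<open>c e + d = e\<close>.\<close>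
  define e where "e = residue_rep p (x * d)"
  have e: "e \<in> {1..p}" unfolding e_def using p0 by (rule residue_rep_bounds)
  have "[(1 - c) * int e = (1 - c) * (x * d)] (mod int p)"
    unfolding e_def by (intro cong_mult cong_refl residue_rep_cong p0)
  also have "[(1 - c) * (x * d) = 1 * d] (mod int p)"
    using cong_mult[OF x cong_refl[of d]] by (simp only: mult.assoc)
  finally have "[c * int e + (1 - c) * int e = c * int e + 1 * d] (mod int p)"
    by (rule cong_add[OF cong_refl])
  then have "[int e = c * int e + d] (mod int p)" by (simp add: algebra_simps)
  then have "[int (f e) = int e] (mod int p)"
    using f(2) e unfolding affine_mod_def by (metis cong_sym cong_trans)
  moreover have "f e \<in> {1..p}" using e by (simp only: permutes_in_image[OF f(1)])
  ultimately have fe: "f e = e" using cong_imp_eq_in_range e by blast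
  have period: "(f ^^ n) i = i \<longleftrightarrow> m dvd n" if i: "i \<in> {1..p}" "i \<noteq> e" for i n
  proof -
    have "\<not> int p dvd int i - int e"
      using cong_imp_eq_in_range[OF i(1) e] i(2) by (auto simp: cong_iff_dvd_diff)
    then have cop: "coprime (int i - int e) (int p)" by (simp add: p_coprime_right_int)
    have "(f ^^ n) i \<in> {1..p}" using permutes_in_image[OF permutes_funpow[OF f(1)]] i by simp
    then have "(f ^^ n) i = i \<longleftrightarrow> [int ((f ^^ n) i) = int i] (mod int p)"
      using cong_imp_eq_in_range i(1) by auto
    also have "\<dots> \<longleftrightarrow> [int ((f ^^ n) i) - int e = int i - int e] (mod int p)"
      by (simp add: cong_iff_dvd_diff)
    also have "\<dots> \<longleftrightarrow> [c ^ n * (int i - int e) = 1 * (int i - int e)] (mod int p)"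
      using affine_mod_funpow[OF f(2,1) e fe i(1), of n] by (simp add: cong_def)
    also have "\<dots> \<longleftrightarrow> [c ^ n = 1] (mod int p)" using cop by (rule cong_mult_rcancel)
    finally show ?thesis unfolding m_def using ord_units_residue_ring(1)[OF p c(1)] by simp
  qed
  have "m > 0" unfolding m_def by (rule ord_units_residue_ring(2)[OF p c(1)])
  from cycle_type_one_fixed_point[OF f(1) _ e fe this period] show ?thesis by simp
qed

section \<open>The dihedral group and its cosets\<close>

text \<open>The generators have slopes \<open>-1\<close> and \<open>1\<close>, and slopes multiply under composition.\<close>

lemma dihedral_affine:
  assumes "g \<in> dihedral p"
  shows "g permutes {1..p} \<and> (\<exists>s\<in>{1, -1}. \<exists>d. affine_mod p s d g)"
proof -
  have flip: "affine_mod p (-1) 1 (flip p)" "flip p permutes {1..p}"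
    using affine_mod_residue_map[of p "-1" 1] flip_in_sym_group[of p]
    by (simp_all add: flip_def sym_group_carrier)
  have shift: "affine_mod p 1 1 (shift p)" "shift p permutes {1..p}"
    using affine_mod_residue_map[of p 1 1] shift_in_sym_group[of p]
    by (simp_all add: shift_def sym_group_carrier)
  from assms show ?thesis
    unfolding dihedral_def
  proof (induction rule: generate.induct)
    case one
    have "affine_mod p 1 0 id" by (simp add: affine_mod_def)
    then show ?case unfolding sym_group_one using permutes_id by blast
  next
    case (incl h)
    then show ?case using flip shift by blast
  next
    case (inv h)
    then have h: "h permutes {1..p}" using flip shift by blast
    obtain s d where s: "s \<in> {1, -1}" and "affine_mod p s d h" using inv flip shift by blast
    then have "affine_mod p s (- s * d) (Hilbert_Choice.inv h)"
      using h by (intro affine_mod_inv) auto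
    moreover have "inv\<^bsub>sym_group p\<^esub> h = Hilbert_Choice.inv h"
      using h by (simp only: sym_group_inv_equality sym_group_carrier)
    ultimately show ?case using permutes_inv[OF h] s by metis
  next
    case (eng g h)
    then obtain s d s' d' where *: "s \<in> {1, -1}" "s' \<in> {1, -1}"
        "affine_mod p s d g" "affine_mod p s' d' h"
      by blast
    have "affine_mod p (s * s') (s * d' + d) (g \<circ> h)" using affine_mod_comp * eng by blast
    moreover have "s * s' \<in> {1, -1}" using * by auto
    moreover have "g \<circ> h permutes {1..p}" using eng permutes_compose by blast
    ultimately show ?case unfolding sym_group_mult by blast
  qed
qed

theorem corollary4:
  fixes p :: nat and a :: int
  assumes "prime p" and "panmagic p a"
  shows "cycle_type {1..p} (mult_perm p a) =
           {#1#} + replicate_mset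
             ((p - 1) div group.ord (units_of (residue_ring (int p))) a)
             (group.ord (units_of (residue_ring (int p))) a) \<and>
         (\<forall>\<sigma> \<in> mult_perm p a <#\<^bsub>sym_group p\<^esub> dihedral p.
           cycle_type {1..p} \<sigma> = cycle_type {1..p} (mult_perm p a) \<or>
           cycle_type {1..p} \<sigma> = cycle_type {1..p} (mult_perm p (\<ominus>\<^bsub>residue_ring (int p)\<^esub> a)))"
proof -
  let ?R = "residue_ring (int p)"
  interpret residues_prime p ?R using assms(1) by unfold_locales simp_all
  \<comment> \<open>\<open>b\<close> is the second possible slope: \<open>- a\<close> as an element of the residue ring.\<close>
  define b where "b = \<ominus>\<^bsub>?R\<^esub> a"
  have aU: "a \<in> Units ?R" and a1: "a \<oplus>\<^bsub>?R\<^esub> \<one>\<^bsub>?R\<^esub> \<in> Units ?R" "a \<ominus>\<^bsub>?R\<^esub> \<one>\<^bsub>?R\<^esub> \<in> Units ?R"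
    using assms(2) by (simp_all add: panmagic_def Let_def)
  have b: "b = (- a) mod int p" unfolding b_def by (rule res_neg_eq)
  have bU: "b \<in> Units ?R"
    unfolding b using aU by (intro mod_in_res_units) (simp_all add: res_units_eq)
  have zero: "\<zero>\<^bsub>?R\<^esub> \<notin> Units ?R" by (simp add: res_prime_units_eq res_zero_eq)
  have aC: "a \<in> carrier ?R" using aU by (rule Units_closed)
  have "a \<ominus>\<^bsub>?R\<^esub> \<one>\<^bsub>?R\<^esub> = \<zero>\<^bsub>?R\<^esub>" if "a = 1"
    using that r_neg[OF one_closed] by (simp add: a_minus_def res_one_eq)
  then have "a \<noteq> 1" using a1(2) zero by metis
  have "a \<oplus>\<^bsub>?R\<^esub> \<one>\<^bsub>?R\<^esub> = \<zero>\<^bsub>?R\<^esub>" if "b = 1"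
    using that r_neg[OF aC] by (simp add: b_def res_one_eq)
  then have "b \<noteq> 1" using a1(1) zero by metis
  have mult: "affine_mod p c 0 (mult_perm p c)" "mult_perm p c permutes {1..p}" if "c \<in> Units ?R" for c
  proof -
    show "affine_mod p c 0 (mult_perm p c)"
      using affine_mod_residue_map[of p c 0] by (simp add: mult_perm_def)
    show "mult_perm p c permutes {1..p}"
      using that mult_perm_in_sym_group[of c p] by (simp add: res_units_eq sym_group_carrier)
  qed
  have ct: "cycle_type {1..p} \<sigma> = cycle_type {1..p} (mult_perm p c)"
    if "c \<in> Units ?R" "c \<noteq> 1" "\<sigma> permutes {1..p}" "affine_mod p c d \<sigma>" for c d \<sigma>
    using cycle_type_affine[OF assms(1)] mult that by metis
  have "cycle_type {1..p} \<sigma> = cycle_type {1..p} (mult_perm p a) \<or>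
      cycle_type {1..p} \<sigma> = cycle_type {1..p} (mult_perm p b)"
    if "\<sigma> \<in> mult_perm p a <#\<^bsub>sym_group p\<^esub> dihedral p" for \<sigma>
  proof -
    obtain g where g: "g \<in> dihedral p" and \<sigma>: "\<sigma> = mult_perm p a \<circ> g"
      using \<open>\<sigma> \<in> _\<close> by (auto simp: l_coset_def sym_group_mult)
    obtain s d where s: "s \<in> {1, -1}" and gs: "affine_mod p s d g" and gp: "g permutes {1..p}"
      using dihedral_affine[OF g] by blast
    have perm: "\<sigma> permutes {1..p}" unfolding \<sigma> using permutes_compose[OF gp mult(2)[OF aU]] .
    have aff: "affine_mod p (a * s) (a * d + 0) \<sigma>"
      unfolding \<sigma> using mult(1)[OF aU] gs gp by (rule affine_mod_comp)
    show ?thesis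
    proof (cases "s = 1")
      case True
      then show ?thesis using ct[OF aU \<open>a \<noteq> 1\<close> perm] aff by simp
    next
      case False
      have "[a * s = b] (mod int p)" using False s by (simp add: b cong_def)
      from affine_mod_cong_slope[OF aff this] show ?thesis
        using ct[OF bU \<open>b \<noteq> 1\<close> perm] by simp
    qed
  qed
  then show ?thesis
    using cycle_type_affine[OF assms(1) aU \<open>a \<noteq> 1\<close> mult(2,1)[OF aU]] unfolding b_def by blast
qed

end
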